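(* Let $\Omega\subset\mathbb{R}^n$ be compact, $f\in C(\Omega)$ real-valued, $\rho:\mathbb{R}\to\mathbb{R}$ monotonically (strictly) decreasing with $\rho(f(x))>0$ for every $x\in\Omega$, $\tau(x)=\rho(f(x))$, and $m^{(k)}(x)=\tau^k(x)/\int_\Omega\tau^k(t)\,\mathrm{d}t$ for $x\in\Omega$, $k\in\mathbb{R}$. Then for every $k\in\mathbb{R}$, $$\frac{\mathrm{d}}{\mathrm{d}k}\int_\Omega f(x)\,m^{(k)}(x)\,\mathrm{d}x\leqslant0.$$ In particular, if $\tau=e^{-f}$ and $f$ is not a constant function on $\Omega$, then $$\frac{\mathrm{d}}{\mathrm{d}k}\int_\Omega f(x)\,m^{(k)}(x)\,\mathrm{d}x=-\mathrm{Var}^{(k)}(f)<0,$$ where $\mathrm{Var}^{(k)}(f)=\int_\Omega\big(f(x)-\mathbb{E}^{(k)}(f)\big)^2m^{(k)}(x)\,\mathrm{d}x$.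
   Context: Integrals are with respect to $n$-dimensional Lebesgue measure $\mu$; it is implicit in the definition of $m^{(k)}$ that $\mu(\Omega)>0$. $\mathbb{E}^{(k)}(f)=\int_\Omega f(t)m^{(k)}(t)\,\mathrm{d}t$.
   Formalization: The strict inequality −Var^(k)(f) < 0 is stated for f not almost everywhere constant on Ω rather than merely not constant: for Ω = [0,1]^n ∪ {p}, f = 0 on the cube and f(p) = 1, f is continuous and not constant but the variance is 0. *)

theory Defs
  imports "HOL-Analysis.Analysis"
begin

text \<open>Below, \<open>\<tau>\<close> is positive on \<open>\<Omega>\<close> and the exponent \<open>k\<close> is an arbitrary real number,
  so that \<open>powr\<close> is the ordinary power. All values of these functions matter on \<open>\<Omega>\<close> only.\<close>

definition pow_density ::
    "('a::euclidean_space) set \<Rightarrow> ('a \<Rightarrow> real) \<Rightarrow> real \<Rightarrow> 'a \<Rightarrow> real" where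
  "pow_density \<Omega> \<tau> k x = \<tau> x powr k / (LINT t:\<Omega>|lebesgue. \<tau> t powr k)"

definition pow_expectation ::
    "('a::euclidean_space) set \<Rightarrow> ('a \<Rightarrow> real) \<Rightarrow> real \<Rightarrow> ('a \<Rightarrow> real) \<Rightarrow> real" where
  "pow_expectation \<Omega> \<tau> k f = (LINT x:\<Omega>|lebesgue. f x * pow_density \<Omega> \<tau> k x)"

definition pow_variance ::
    "('a::euclidean_space) set \<Rightarrow> ('a \<Rightarrow> real) \<Rightarrow> real \<Rightarrow> ('a \<Rightarrow> real) \<Rightarrow> real" where
  "pow_variance \<Omega> \<tau> k f =
     (LINT x:\<Omega>|lebesgue. (f x - pow_expectation \<Omega> \<tau> k f)\<^sup>2 * pow_density \<Omega> \<tau> k x)"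

text \<open>Non-constancy has to be read modulo null sets for a strictly positive variance: on
  \<open>{0..1} \<union> {2}\<close> the function that is 0 on \<open>{0..1}\<close> and 1 at 2 is continuous and not constant,
  but its variance is 0.\<close>

definition ae_constant_on :: "(('a::euclidean_space) \<Rightarrow> real) \<Rightarrow> 'a set \<Rightarrow> bool" where
  "ae_constant_on f \<Omega> \<longleftrightarrow> (\<exists>c. AE x in lebesgue. x \<in> \<Omega> \<longrightarrow> f x = c)"

text \<open>The two readings agree for continuous functions whenever every nonempty relatively open
  subset of \<open>\<Omega>\<close> has positive measure.\<close>

lemma ae_constant_on_iff_constant_on:
  fixes f :: "'a::euclidean_space \<Rightarrow> real"
  assumes f: "continuous_on \<Omega> f"
    and supp: "\<And>U. open U \<Longrightarrow> U \<inter> \<Omega> \<noteq> {} \<Longrightarrow> U \<inter> \<Omega> \<notin> null_sets lebesgue"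
  shows "ae_constant_on f \<Omega> \<longleftrightarrow> f constant_on \<Omega>"
proof
  assume "ae_constant_on f \<Omega>"
  then obtain c where c: "AE x in lebesgue. x \<in> \<Omega> \<longrightarrow> f x = c"
    by (auto simp: ae_constant_on_def)
  obtain U where U: "open U" "U \<inter> \<Omega> = f -` (- {c}) \<inter> \<Omega>"
    using f by (metis continuous_on_open_invariant open_Compl closed_singleton)
  obtain N where N: "N \<in> null_sets lebesgue" "{x. \<not> (x \<in> \<Omega> \<longrightarrow> f x = c)} \<subseteq> N"
    using c unfolding eventually_ae_filter by auto
  have "U \<inter> \<Omega> \<subseteq> N"
    using U N by auto
  then have "U \<inter> \<Omega> \<in> null_sets lebesgue"
    using N(1) completion.complete2 by blast
  then have "U \<inter> \<Omega> = {}"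
    using supp U(1) by blast
  then show "f constant_on \<Omega>"
    using U(2) by (auto simp: constant_on_def)
next
  assume "f constant_on \<Omega>"
  then show "ae_constant_on f \<Omega>"
    by (auto simp: ae_constant_on_def constant_on_def)
qed

end

theory Submission
  imports Defs
begin

text \<open>With \<open>h = ln \<circ> \<tau>\<close>, which is bounded on \<open>\<Omega>\<close>, the expectation is the mean of \<open>f\<close> under the
  exponentially tilted weight \<open>exp (k h)\<close>. Its derivative is the covariance of \<open>f\<close> and \<open>h\<close>, which
  equals the tilted mean of \<open>(f - E) (h - c)\<close> for every constant \<open>c\<close>, where \<open>E\<close> is the mean of \<open>f\<close>.
  Since \<open>h = ln \<circ> \<rho> \<circ> f\<close> with \<open>\<rho>\<close> decreasing, this product is pointwise nonpositive for
  \<open>c = ln (\<rho> E)\<close>.\<close>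

text \<open>The first-order Taylor remainder is at most
  \<open>exp \<bar>u\<bar> * u\<^sup>2\<close>, and the constant comes from exp 1 \<le> 3. The
  quadratic order is what matters: after division by the increment of \<open>k\<close> the error
  still tends to 0.\<close>

lemma exp_first_order_bound:
  fixes u :: real
  assumes "\<bar>u\<bar> \<le> 1"
  shows "\<bar>exp u - 1 - u\<bar> \<le> 3 * u\<^sup>2"
proof -
  have "\<bar>exp u - 1 - u\<bar> \<le> exp \<bar>u\<bar> * u\<^sup>2"
    using Taylor_exp_field[of u 1] by (simp add: diff_diff_eq power2_eq_square)
  also have "\<dots> \<le> 3 * u\<^sup>2"
    using assms by (intro mult_right_mono order_trans[OF _ exp_le]) auto
  finally show ?thesis .
qed

section \<open>Differentiating tilted integrals and means over a finite measure\<close>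

context finite_measure
begin

lemma integrable_mult_exp:
  fixes g h :: "'a \<Rightarrow> real"
  assumes [measurable]: "g \<in> borel_measurable M" "h \<in> borel_measurable M"
    and g: "\<And>x. x \<in> space M \<Longrightarrow> \<bar>g x\<bar> \<le> G"
    and h: "\<And>x. x \<in> space M \<Longrightarrow> \<bar>h x\<bar> \<le> H"
  shows "integrable M (\<lambda>x. g x * exp (k * h x))"
proof (rule integrable_const_bound[where B = "G * exp (\<bar>k\<bar> * H)"])
  show "AE x in M. norm (g x * exp (k * h x)) \<le> G * exp (\<bar>k\<bar> * H)"
  proof (rule AE_I2)
    fix x assume x: "x \<in> space M"
    have "k * h x \<le> \<bar>k\<bar> * H"
      using mult_left_mono[OF h[OF x], of "\<bar>k\<bar>"] abs_ge_self[of "k * h x"] by (simp add: abs_mult)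
    moreover have "0 \<le> G"
      using g[OF x] by linarith
    ultimately show "norm (g x * exp (k * h x)) \<le> G * exp (\<bar>k\<bar> * H)"
      using g[OF x] by (auto simp: abs_mult intro!: mult_mono)
  qed
qed simp

text \<open>Differentiation under the integral sign by an explicit estimate: boundedness of
  \<open>h\<close> makes the linearization error in the increment \<open>s\<close> quadratic
  uniformly in \<open>x\<close>, so integrating it keeps it O(\<open>s\<^sup>2\<close>).\<close>

lemma DERIV_integral_mult_exp:
  fixes g h :: "'a \<Rightarrow> real"
  assumes [measurable]: "g \<in> borel_measurable M" "h \<in> borel_measurable M"
    and g: "\<And>x. x \<in> space M \<Longrightarrow> \<bar>g x\<bar> \<le> G"
    and h: "\<And>x. x \<in> space M \<Longrightarrow> \<bar>h x\<bar> \<le> H"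
  shows "((\<lambda>k. \<integral>x. g x * exp (k * h x) \<partial>M) has_real_derivative
           (\<integral>x. g x * h x * exp (k * h x) \<partial>M)) (at k)"
proof -
  let ?F = "\<lambda>k. \<integral>x. g x * exp (k * h x) \<partial>M"
  let ?D = "\<integral>x. g x * h x * exp (k * h x) \<partial>M"
  define C where "C = (\<integral>x. \<bar>g x\<bar> * exp (k * h x) \<partial>M) * (3 * H\<^sup>2)"
  have gh: "\<bar>g x * h x\<bar> \<le> G * H" if "x \<in> space M" for x
    using g[OF that] h[OF that] by (auto simp: abs_mult intro!: mult_mono)
  have int: "integrable M (\<lambda>x. g x * exp (k * h x))" for k
    by (rule integrable_mult_exp) (use g h in auto)
  have int_gh: "integrable M (\<lambda>x. g x * h x * exp (k * h x))"
    by (rule integrable_mult_exp[OF _ _ gh h]) auto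
  have int_abs: "integrable M (\<lambda>x. \<bar>g x\<bar> * exp (k * h x))"
    by (rule integrable_mult_exp[where G = G and H = H]) (use g h in auto)
  \<comment> \<open>The restriction \<open>\<bar>s\<bar> * H \<le> 1\<close> puts
    \<open>s * h x\<close> in the range of the Taylor bound at every point simultaneously;
    \<open>C\<close> does not depend on \<open>s\<close>.\<close>
  have remainder: "\<bar>(?F (k + s) - ?F k) / s - ?D\<bar> \<le> C * \<bar>s\<bar>"
    if s: "s \<noteq> 0" "\<bar>s\<bar> * H \<le> 1" for s
  proof -
    have "\<bar>?F (k + s) - ?F k - s * ?D\<bar> =
        \<bar>\<integral>x. g x * exp ((k + s) * h x) - g x * exp (k * h x) - s * (g x * h x * exp (k * h x)) \<partial>M\<bar>"
      using int int_gh by simp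
    also have "\<dots> \<le> (\<integral>x. (\<bar>g x\<bar> * exp (k * h x)) * (3 * H\<^sup>2 * s\<^sup>2) \<partial>M)"
    proof (rule order_trans[OF integral_abs_bound integral_mono])
      show "integrable M (\<lambda>x. \<bar>g x * exp ((k + s) * h x) - g x * exp (k * h x)
              - s * (g x * h x * exp (k * h x))\<bar>)"
        using int int_gh by simp
      show "integrable M (\<lambda>x. (\<bar>g x\<bar> * exp (k * h x)) * (3 * H\<^sup>2 * s\<^sup>2))"
        using int_abs by simp
      fix x assume x: "x \<in> space M"
      have sh: "\<bar>s * h x\<bar> \<le> \<bar>s\<bar> * H"
        using h[OF x] by (simp add: abs_mult mult_left_mono)
      have "\<bar>exp (s * h x) - 1 - s * h x\<bar> \<le> 3 * (s * h x)\<^sup>2"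
        using exp_first_order_bound sh s by simp
      also have "\<dots> \<le> 3 * H\<^sup>2 * s\<^sup>2"
        using power_mono[OF sh, of 2] by (simp add: power_mult_distrib mult.commute)
      finally have "\<bar>g x * exp (k * h x)\<bar> * \<bar>exp (s * h x) - 1 - s * h x\<bar>
          \<le> \<bar>g x * exp (k * h x)\<bar> * (3 * H\<^sup>2 * s\<^sup>2)"
        by (rule mult_left_mono) simp
      \<comment> \<open>Factoring out \<open>exp (k * h x)\<close> leaves the Taylor remainder of
        exp at \<open>s * h x\<close>.\<close>
      moreover have "g x * exp ((k + s) * h x) - g x * exp (k * h x) - s * (g x * h x * exp (k * h x))
          = g x * exp (k * h x) * (exp (s * h x) - 1 - s * h x)"
        by (simp add: algebra_simps exp_add)
      ultimately show "\<bar>g x * exp ((k + s) * h x) - g x * exp (k * h x)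
          - s * (g x * h x * exp (k * h x))\<bar> \<le> (\<bar>g x\<bar> * exp (k * h x)) * (3 * H\<^sup>2 * s\<^sup>2)"
        by (simp add: abs_mult)
    qed
    also have "\<dots> = C * s\<^sup>2"
      unfolding C_def integral_mult_left_zero by (simp only: mult.assoc)
    finally have "\<bar>?F (k + s) - ?F k - s * ?D\<bar> / \<bar>s\<bar> \<le> C * s\<^sup>2 / \<bar>s\<bar>"
      by (rule divide_right_mono) simp
    moreover have "(?F (k + s) - ?F k) / s - ?D = (?F (k + s) - ?F k - s * ?D) / s"
      using s(1) by (simp add: diff_divide_distrib)
    moreover have "C * s\<^sup>2 / \<bar>s\<bar> = C * \<bar>s\<bar>"
      using s(1) by (simp add: divide_eq_eq power2_eq_square)
    ultimately show ?thesis
      by (simp add: abs_divide)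
  qed
  \<comment> \<open>All sufficiently small \<open>s\<close> satisfy the restriction, so the
    remainder estimate squeezes the difference quotient.\<close>
  have "((\<lambda>s. \<bar>s\<bar> * H) \<longlongrightarrow> \<bar>0\<bar> * H) (at 0)"
    by (intro tendsto_intros)
  then have "\<forall>\<^sub>F s in at 0. \<bar>s\<bar> * H < 1"
    by (rule order_tendstoD) simp
  moreover have "\<forall>\<^sub>F s::real in at 0. s \<noteq> 0"
    by (simp add: eventually_at_filter)
  ultimately have "\<forall>\<^sub>F s in at 0. norm ((?F (k + s) - ?F k) / s - ?D) \<le> C * \<bar>s\<bar>"
    by eventually_elim (use remainder in simp)
  moreover have "((\<lambda>s. C * \<bar>s\<bar>) \<longlongrightarrow> 0) (at 0)"
    by (auto intro!: tendsto_eq_intros)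
  ultimately have "((\<lambda>s. (?F (k + s) - ?F k) / s - ?D) \<longlongrightarrow> 0) (at 0)"
    by (rule Lim_null_comparison)
  then show ?thesis
    unfolding DERIV_def by (rule LIM_zero_cancel)
qed

lemma integral_exp_pos:
  fixes h :: "'a \<Rightarrow> real"
  assumes "h \<in> borel_measurable M" "\<And>x. x \<in> space M \<Longrightarrow> \<bar>h x\<bar> \<le> H"
    and "emeasure M (space M) \<noteq> 0"
  shows "0 < (\<integral>x. exp (k * h x) \<partial>M)"
proof -
  have int: "integrable M (\<lambda>x. exp (k * h x))"
    using integrable_mult_exp[of "\<lambda>_. 1" h 1 H k] assms by simp
  have "(\<integral>x. exp (k * h x) \<partial>M) \<noteq> 0"
  proof
    assume "(\<integral>x. exp (k * h x) \<partial>M) = 0"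
    then have "AE x in M. exp (k * h x) = 0"
      using integral_nonneg_eq_0_iff_AE[OF int] by simp
    then have "AE x in M. False"
      by eventually_elim simp
    then show False
      using assms(3) by (simp add: AE_iff_measurable[OF _ refl])
  qed
  moreover have "0 \<le> (\<integral>x. exp (k * h x) \<partial>M)"
    by simp
  ultimately show ?thesis
    by linarith
qed

text \<open>The quotient rule yields the tilted covariance of \<open>f\<close> and \<open>h\<close>.
  Since \<open>f - E k\<close> has tilted mean 0, shifting \<open>h\<close> by any constant
  \<open>c\<close> leaves it unchanged; this freedom is used below with two different choices of
  \<open>c\<close>.\<close>

lemma DERIV_tilted_mean:
  fixes f h :: "'a \<Rightarrow> real" and k c :: real
  assumes [measurable]: "f \<in> borel_measurable M" "h \<in> borel_measurable M"
    and f: "\<And>x. x \<in> space M \<Longrightarrow> \<bar>f x\<bar> \<le> G"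
    and h: "\<And>x. x \<in> space M \<Longrightarrow> \<bar>h x\<bar> \<le> H"
    and M: "emeasure M (space M) \<noteq> 0"
  defines "B \<equiv> (\<lambda>k. \<integral>x. exp (k * h x) \<partial>M)"
  defines "E \<equiv> (\<lambda>k. (\<integral>x. f x * exp (k * h x) \<partial>M) / B k)"
  shows "(E has_real_derivative
           (\<integral>x. (f x - E k) * (h x - c) * exp (k * h x) \<partial>M) / B k) (at k)"
proof -
  define A where "A = (\<lambda>k. \<integral>x. f x * exp (k * h x) \<partial>M)"
  define A' where "A' = (\<integral>x. f x * h x * exp (k * h x) \<partial>M)"
  define B' where "B' = (\<integral>x. h x * exp (k * h x) \<partial>M)"
  have B: "B k > 0"
    unfolding B_def by (rule integral_exp_pos[OF _ h M]) simp
  have fh: "\<bar>f x * h x\<bar> \<le> G * H" if "x \<in> space M" for x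
    using f[OF that] h[OF that] by (auto simp: abs_mult intro!: mult_mono)
  have A': "(A has_real_derivative A') (at k)"
    unfolding A_def A'_def by (rule DERIV_integral_mult_exp[OF _ _ f h]) auto
  have B': "(B has_real_derivative B') (at k)"
    using DERIV_integral_mult_exp[of "\<lambda>_. 1" h 1 H k] h by (simp add: B_def B'_def)
  have int: "integrable M (\<lambda>x. f x * exp (k * h x))" "integrable M (\<lambda>x. h x * exp (k * h x))"
    "integrable M (\<lambda>x. f x * h x * exp (k * h x))" "integrable M (\<lambda>x. exp (k * h x))"
    using integrable_mult_exp[OF _ _ f h, where k = k] integrable_mult_exp[OF _ _ h h, where k = k]
      integrable_mult_exp[OF _ _ fh h, where k = k] integrable_mult_exp[of "\<lambda>_. 1" h 1 H k] h
    by simp_all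
  have "(\<integral>x. (f x - E k) * (h x - c) * exp (k * h x) \<partial>M) =
      (\<integral>x. f x * h x * exp (k * h x) - c * (f x * exp (k * h x))
         - E k * (h x * exp (k * h x)) + E k * c * exp (k * h x) \<partial>M)"
    by (rule Bochner_Integration.integral_cong) (auto simp: algebra_simps)
  also have "\<dots> = A' - c * A k - E k * B' + E k * c * B k"
    using int by (simp add: A_def A'_def B_def B'_def)
  \<comment> \<open>Here \<open>E k * B k = A k\<close>, so the two terms containing
    \<open>c\<close> cancel.\<close>
  also have "\<dots> = A' - E k * B'"
    using B by (simp add: E_def A_def)
  also have "\<dots> / B k = (A' * B k - A k * B') / (B k * B k)"
    using B by (simp add: E_def A_def field_simps)
  finally have "(\<integral>x. (f x - E k) * (h x - c) * exp (k * h x) \<partial>M) / B k =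
      (A' * B k - A k * B') / (B k * B k)" .
  moreover have "E = (\<lambda>k. A k / B k)"
    by (simp add: E_def A_def)
  ultimately show ?thesis
    using DERIV_divide[OF A' B'] B by simp
qed

end

theorem theorem4:
  fixes \<Omega> :: "(real ^ 'n) set"
    and f \<tau> :: "real ^ 'n \<Rightarrow> real"
    and \<rho> :: "real \<Rightarrow> real"
  assumes "compact \<Omega>"
    and "emeasure lebesgue \<Omega> > 0"
    and "continuous_on \<Omega> f"
    and "\<And>x y. x < y \<Longrightarrow> \<rho> y < \<rho> x"
    and "\<And>x. x \<in> \<Omega> \<Longrightarrow> \<rho> (f x) > 0"
    and "\<And>x. x \<in> \<Omega> \<Longrightarrow> \<tau> x = \<rho> (f x)"
  shows "(\<forall>k. \<exists>D. ((\<lambda>k. LINT x:\<Omega>|lebesgue. f x * pow_density \<Omega> \<tau> k x)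
                    has_real_derivative D) (at k) \<and> D \<le> 0)
    \<and> ((\<forall>x\<in>\<Omega>. \<tau> x = exp (- f x)) \<and> \<not> f constant_on \<Omega> \<longrightarrow>
        (\<forall>k. ((\<lambda>k. LINT x:\<Omega>|lebesgue. f x * pow_density \<Omega> \<tau> k x)
                has_real_derivative - pow_variance \<Omega> \<tau> k f) (at k)
             \<and> (\<not> ae_constant_on f \<Omega> \<longrightarrow> - pow_variance \<Omega> \<tau> k f < 0)))"
proof -

  \<comment> \<open>Reduction to a tilted mean with a bounded exponent\<close>
  define h where "h = (\<lambda>x. ln (\<rho> (f x)))"
  define B where "B = (\<lambda>k. \<integral>x. exp (k * h x) \<partial>lebesgue_on \<Omega>)"
  define E where "E = (\<lambda>k. (\<integral>x. f x * exp (k * h x) \<partial>lebesgue_on \<Omega>) / B k)"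
  have \<Omega>: "\<Omega> \<in> sets lebesgue"
    using assms(1) by (simp add: borel_compact)
  have \<Omega>ne: "\<Omega> \<noteq> {}"
    using assms(2) by auto
  interpret finite_measure "lebesgue_on \<Omega>"
    by (intro finite_measure_lebesgue_on lmeasurable_compact assms(1))
  have set_integral: "(LINT x:\<Omega>|lebesgue. g x) = (\<integral>x. g x \<partial>lebesgue_on \<Omega>)" for g :: "_ \<Rightarrow> real"
    using \<Omega> by (simp add: set_lebesgue_integral_def integral_restrict_space)
  have nonnull: "emeasure (lebesgue_on \<Omega>) (space (lebesgue_on \<Omega>)) \<noteq> 0"
    using assms(2) \<Omega> by (simp add: emeasure_restrict_space)
  have \<rho>_mono: "\<rho> y \<le> \<rho> x" if "x \<le> y" for x y
    using assms(4)[of x y] that by (cases "x = y") auto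
  \<comment> \<open>A decreasing function may jump, so measurability comes from monotonicity of its
    negative rather than from continuity.\<close>
  have [measurable]: "\<rho> \<in> borel_measurable borel"
  proof -
    have "(\<lambda>x. - \<rho> x) \<in> borel_measurable borel"
      by (rule borel_measurable_mono) (auto intro!: monoI \<rho>_mono)
    then show ?thesis
      by simp
  qed
  have f_meas [measurable]: "f \<in> borel_measurable (lebesgue_on \<Omega>)"
    using continuous_imp_measurable_on_sets_lebesgue[OF assms(3) \<Omega>] .
  have h_meas [measurable]: "h \<in> borel_measurable (lebesgue_on \<Omega>)"
    unfolding h_def by measurable
  obtain p q where p: "p \<in> \<Omega>" "\<And>x. x \<in> \<Omega> \<Longrightarrow> f p \<le> f x"
    and q: "q \<in> \<Omega>" "\<And>x. x \<in> \<Omega> \<Longrightarrow> f x \<le> f q"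
    using continuous_attains_inf[OF assms(1) \<Omega>ne assms(3)]
      continuous_attains_sup[OF assms(1) \<Omega>ne assms(3)] by metis
  define G where "G = \<bar>f p\<bar> + \<bar>f q\<bar>"
  \<comment> \<open>As \<open>h\<close> may be discontinuous, its bound is not taken from
    compactness directly: \<open>h\<close> is a decreasing function of \<open>f\<close>, so its
    extreme values occur at the maximizer \<open>q\<close> and the minimizer \<open>p\<close> of
    \<open>f\<close>.\<close>
  define H where "H = \<bar>h p\<bar> + \<bar>h q\<bar>"
  have f_bound: "\<bar>f x\<bar> \<le> G" if "x \<in> space (lebesgue_on \<Omega>)" for x
    using p(2)[of x] q(2)[of x] that by (auto simp: G_def)
  have h_bound: "\<bar>h x\<bar> \<le> H" if "x \<in> space (lebesgue_on \<Omega>)" for x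
  proof -
    have "x \<in> \<Omega>" using that by simp
    then have "h q \<le> h x" "h x \<le> h p"
      using p q assms(5) by (auto simp: h_def intro!: \<rho>_mono)
    then show ?thesis
      by (auto simp: H_def)
  qed
  have B_pos: "B k > 0" for k
    unfolding B_def by (rule integral_exp_pos[OF h_meas h_bound nonnull])
  have powr_eq: "\<tau> x powr k = exp (k * h x)" if "x \<in> \<Omega>" for x k
    using assms(5)[OF that] assms(6)[OF that] by (simp add: powr_def h_def)
  have integral_density: "(LINT x:\<Omega>|lebesgue. g x * pow_density \<Omega> \<tau> k x) =
      (\<integral>x. g x * exp (k * h x) \<partial>lebesgue_on \<Omega>) / B k" for g k
  proof -
    have "(\<integral>t. \<tau> t powr k \<partial>lebesgue_on \<Omega>) = B k"
      unfolding B_def by (rule Bochner_Integration.integral_cong) (auto simp: powr_eq)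
    then have "(\<integral>x. g x * pow_density \<Omega> \<tau> k x \<partial>lebesgue_on \<Omega>) =
        (\<integral>x. g x * exp (k * h x) / B k \<partial>lebesgue_on \<Omega>)"
      by (intro Bochner_Integration.integral_cong)
        (auto simp: pow_density_def set_integral powr_eq)
    then show ?thesis
      by (simp add: set_integral)
  qed
  have E_eq: "(\<lambda>k. LINT x:\<Omega>|lebesgue. f x * pow_density \<Omega> \<tau> k x) = E"
    by (simp add: integral_density E_def)
  have deriv: "(E has_real_derivative
      (\<integral>x. (f x - E k) * (h x - c) * exp (k * h x) \<partial>lebesgue_on \<Omega>) / B k) (at k)" for k c
    unfolding E_def B_def by (rule DERIV_tilted_mean[OF f_meas h_meas f_bound h_bound nonnull])
  have sq_int: "integrable (lebesgue_on \<Omega>) (\<lambda>x. (f x - e)\<^sup>2 * exp (k * h x))" for e k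
  proof (rule integrable_mult_exp[OF _ h_meas _ h_bound])
    show "\<bar>(f x - e)\<^sup>2\<bar> \<le> (G + \<bar>e\<bar>)\<^sup>2" if "x \<in> space (lebesgue_on \<Omega>)" for x
      using f_bound[OF that] by (auto simp: abs_le_square_iff[symmetric])
  qed simp_all
  have variance: "pow_variance \<Omega> \<tau> k f =
      (\<integral>x. (f x - E k)\<^sup>2 * exp (k * h x) \<partial>lebesgue_on \<Omega>) / B k" for k
    by (simp add: pow_variance_def pow_expectation_def integral_density E_def)

  \<comment> \<open>Sign of the derivative for a decreasing weight\<close>
  have "\<exists>D. (E has_real_derivative D) (at k) \<and> D \<le> 0" for k
  proof -
    \<comment> \<open>The mean \<open>E k\<close> need not be a value of \<open>f\<close> on
      \<open>\<Omega>\<close>, while \<open>\<rho>\<close> is only known to be positive at such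
      values. Bounding the mean by the maximum \<open>f q\<close> gives
      \<open>\<rho> (E k) \<ge> \<rho> (f q) > 0\<close>, so that \<open>ln (\<rho> (E k))\<close>
      is a meaningful threshold.\<close>
    have "(\<integral>x. f x * exp (k * h x) \<partial>lebesgue_on \<Omega>) \<le> (\<integral>x. f q * exp (k * h x) \<partial>lebesgue_on \<Omega>)"
    proof (rule integral_mono)
      show "integrable (lebesgue_on \<Omega>) (\<lambda>x. f x * exp (k * h x))"
        by (rule integrable_mult_exp[OF f_meas h_meas f_bound h_bound])
      show "integrable (lebesgue_on \<Omega>) (\<lambda>x. f q * exp (k * h x))"
        by (rule integrable_mult_exp[OF _ h_meas order_refl h_bound]) simp_all
    qed (use q(2) in simp)
    then have "E k \<le> f q"
      using B_pos[of k] by (simp add: E_def B_def field_simps)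
    then have \<rho>E: "\<rho> (E k) > 0"
      using \<rho>_mono[of "E k" "f q"] assms(5)[OF q(1)] by linarith
    have "(f x - E k) * (h x - ln (\<rho> (E k))) \<le> 0" if "x \<in> \<Omega>" for x
    proof (cases "f x \<le> E k")
      case True
      then have "ln (\<rho> (E k)) \<le> h x"
        using \<rho>E \<rho>_mono[OF True] by (simp add: h_def)
      then show ?thesis
        using True by (simp add: mult_nonpos_nonneg)
    next
      case False
      then have "h x \<le> ln (\<rho> (E k))"
        using assms(5)[OF that] \<rho>E \<rho>_mono[of "E k" "f x"] by (simp add: h_def)
      then show ?thesis
        using False by (simp add: mult_nonneg_nonpos)
    qed
    then have "0 \<le> (\<integral>x. - ((f x - E k) * (h x - ln (\<rho> (E k))) * exp (k * h x)) \<partial>lebesgue_on \<Omega>)"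
      by (intro integral_nonneg_AE AE_I2) (auto simp: mult_nonpos_nonneg)
    then show ?thesis
      using deriv[of k "ln (\<rho> (E k))"] B_pos[of k] by (auto simp: divide_nonpos_pos)
  qed

  \<comment> \<open>The exponential weight and its variance\<close>
  moreover have "(E has_real_derivative - pow_variance \<Omega> \<tau> k f) (at k)"
    if \<tau>: "\<forall>x\<in>\<Omega>. \<tau> x = exp (- f x)" for k
  proof -
    have h: "h x = - f x" if "x \<in> \<Omega>" for x
      using \<tau> that unfolding h_def assms(6)[OF that, symmetric] by simp
    \<comment> \<open>With \<open>h = - f\<close> on \<open>\<Omega>\<close>, the choice
      \<open>c = - E k\<close> turns the covariance integrand into minus the squared
      deviation.\<close>
    have "(\<integral>x. (f x - E k) * (h x - (- E k)) * exp (k * h x) \<partial>lebesgue_on \<Omega>) =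
        (\<integral>x. - ((f x - E k)\<^sup>2 * exp (k * h x)) \<partial>lebesgue_on \<Omega>)"
      by (rule Bochner_Integration.integral_cong) (auto simp: h power2_eq_square algebra_simps)
    then show ?thesis
      using deriv[of k "- E k"] by (simp add: variance)
  qed
  moreover have "0 < pow_variance \<Omega> \<tau> k f" if nconst: "\<not> ae_constant_on f \<Omega>" for k
  proof -
    let ?V = "\<integral>x. (f x - E k)\<^sup>2 * exp (k * h x) \<partial>lebesgue_on \<Omega>"
    have "?V \<noteq> 0"
    proof
      assume "?V = 0"
      \<comment> \<open>The exponential factor never vanishes, so zero variance forces
        \<open>f = E k\<close> almost everywhere on \<open>\<Omega>\<close>, which makes
        \<open>E k\<close> the witness contradicting \<open>nconst\<close>.\<close>
      then have "AE x in lebesgue_on \<Omega>. (f x - E k)\<^sup>2 * exp (k * h x) = 0"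
        using integral_nonneg_eq_0_iff_AE[OF sq_int] by simp
      then have "AE x in lebesgue. x \<in> \<Omega> \<longrightarrow> f x = E k"
        using \<Omega> by (simp add: AE_restrict_space_iff)
      then show False
        using nconst by (auto simp: ae_constant_on_def)
    qed
    moreover have "0 \<le> ?V"
      by (intro integral_nonneg_AE AE_I2) simp
    ultimately have "0 < ?V"
      by linarith
    from divide_pos_pos[OF this B_pos[of k]] show ?thesis
      by (simp only: variance)
  qed
  ultimately show ?thesis
    unfolding E_eq by simp
qed

end
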